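(* Let $p>3$ be prime and $1\le \ell\le p-1$. For every $A=\begin{pmatrix} a&b\\ c&d\end{pmatrix}\in\Gamma_0(p)$, $$\big(\mathcal{F}_1(\ell;z)\big)\big|[A]_1=\mu(A,\ell)\,\mathcal{F}_1(\overline{d\ell};z),\qquad \mu(A,\ell)=\exp\!\left(\pi i\left(\frac{\ell(d-1)}{p}+\frac{cd\ell^2}{p^2}-\frac{c\ell}{p}\right)\right),$$ where $\overline{m}$ denotes the least nonnegative residue of $m$ modulo $p$.
   Context: $z$ lies in the upper half-plane, $q=e^{2\pi i z}$ and $q^r:=e^{2\pi i r z}$ for rational $r$; $\zeta_p=e^{2\pi i/p}$. For $A=\begin{pmatrix} a&b\\ c&d\end{pmatrix}\in SL_2(\mathbb{Z})$ the weight-$k$ slash operator is $(F|[A]_k)(z)=(cz+d)^{-k}F\big(\tfrac{az+b}{cz+d}\big)$. $\eta(z)=q^{1/24}\prod_{n\ge1}(1-q^n)$. For real $g,h$ not both $\equiv 0 \pmod p$, Yang's generalized eta function is $E_{g,h}(z)=q^{B(g/p)/2}\prod_{m\ge1}(1-\zeta_p^{h}q^{m-1+g/p})(1-\zeta_p^{-h}q^{m-g/p})$ with $B(x)=x^2-x+\tfrac16$; in particular $E_{0,\ell}(z)=q^{1/12}\prod_{m\ge1}(1-\zeta_p^{\ell}q^{m-1})(1-\zeta_p^{-\ell}q^{m})$. Define $\mathcal{F}_1(\ell;z)=\eta(z)^2/E_{0,\ell}(z)$ for $1\le\ell\le p-1$. *)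

theory Defs
  imports "HOL-Analysis.Analysis"
begin

definition qpow :: "real \<Rightarrow> complex \<Rightarrow> complex" where
  "qpow r z = exp (2 * of_real pi * \<i> * of_real r * z)"

definition zeta_pow :: "nat \<Rightarrow> int \<Rightarrow> complex" where
  "zeta_pow p h = exp (2 * of_real pi * \<i> * of_int h / of_nat p)"

definition dedekind_eta :: "complex \<Rightarrow> complex" where
  "dedekind_eta z = qpow (1/24) z * (\<Prod>n. (1 - qpow (real (Suc n)) z))"

definition E0 :: "nat \<Rightarrow> int \<Rightarrow> complex \<Rightarrow> complex" where
  "E0 p l z = qpow (1/12) z *
     (\<Prod>m. (1 - zeta_pow p l * qpow (real m) z) * (1 - zeta_pow p (- l) * qpow (real (Suc m)) z))"

definition F1 :: "nat \<Rightarrow> int \<Rightarrow> complex \<Rightarrow> complex" where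
  "F1 p l z = (dedekind_eta z)^2 / E0 p l z"

definition slash :: "int \<Rightarrow> int \<Rightarrow> int \<Rightarrow> int \<Rightarrow> int \<Rightarrow> (complex \<Rightarrow> complex) \<Rightarrow> complex \<Rightarrow> complex" where
  "slash k a b c d F z = (of_int c * z + of_int d) powi (- k) *
      F ((of_int a * z + of_int b) / (of_int c * z + of_int d))"

definition Gamma0 :: "nat \<Rightarrow> int \<Rightarrow> int \<Rightarrow> int \<Rightarrow> int \<Rightarrow> bool" where
  "Gamma0 N a b c d \<longleftrightarrow> a * d - b * c = 1 \<and> int N dvd c"

definition mu :: "nat \<Rightarrow> int \<Rightarrow> int \<Rightarrow> int \<Rightarrow> complex" where
  "mu p c d l = exp (of_real pi * \<i> *
      (of_int (l * (d - 1)) / of_nat p + of_int (c * d * l^2) / of_nat p ^ 2 - of_int (c * l) / of_nat p))"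

end

theory Submission
  imports Defs "HOL-Complex_Analysis.Complex_Analysis"
begin

text \<open>
  With \<open>K(u, z) = -\<i> \<theta>\<^sub>1(u, z) / \<eta>(z)\<^sup>3\<close> one has
  \<open>F1 p l z = exp(-\<pi>\<i>l/p) / K(l/p, z)\<close>. As a function of \<open>u\<close>, \<open>K\<close> is entire and quasi-periodic
  with simple zeros exactly at the lattice points. For a matrix of determinant 1, the function
  \<open>(cz + d) exp(-\<pi>\<i>cu\<^sup>2/(cz + d)) K(u/(cz + d), (az + b)/(cz + d))\<close> has the same quasi-periods and
  the same derivative at 0, so by Liouville's theorem it equals \<open>K(u, z)\<close>; neither generators of
  the modular group nor the transformation law of \<open>\<eta>\<close> are needed. Taking \<open>u = (l/p)(cz + d)\<close>, which
  differs from \<open>dl/p\<close> by the lattice vector \<open>(cl/p) z\<close>, gives the theorem.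
\<close>

section \<open>Integer shifts and exponentials of integer multiples of pi i\<close>

lemma shift_invariant_int:
  fixes G :: "int \<Rightarrow> 'a"
  assumes "\<And>m. G (m + 1) = G m"
  shows "G m = G 0"
proof (induction m rule: int_induct[where k = 0])
  case (step2 i)
  then show ?case using assms[of "i - 1"] by simp
qed (use assms in auto)

lemma exp_pi_i_even: "exp (of_real pi * \<i> * (2 * of_int k)) = (1 :: complex)"
  unfolding exp_eq_1 by (auto intro!: exI[of _ k])

lemma exp_pi_i_odd:
  assumes "odd (k :: int)"
  shows "exp (of_real pi * \<i> * of_int k) = (-1 :: complex)"
proof -
  from assms obtain j where k: "k = 2 * j + 1" by (elim oddE)
  have "exp (of_real pi * \<i> * of_int k) =
      exp (of_real pi * \<i> * (2 * of_int j)) * exp (of_real pi * \<i> :: complex)"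
    unfolding k exp_add[symmetric] by (simp add: algebra_simps)
  then show ?thesis
    unfolding exp_pi_i_even by simp
qed

text \<open>The value is a sign, hence its own inverse.\<close>

lemma exp_pi_i_minus:
  "exp (- (of_real pi * \<i> * of_int k)) = (exp (of_real pi * \<i> * of_int k) :: complex)"
proof -
  have "exp (of_real pi * \<i> * of_int k) =
      exp (of_real pi * \<i> * (2 * of_int k)) * (exp (- (of_real pi * \<i> * of_int k)) :: complex)"
    unfolding exp_add[symmetric] by (simp add: algebra_simps)
  then show ?thesis
    unfolding exp_pi_i_even by simp
qed

subsection \<open>Quasi-periodic entire functions\<close>

text \<open>Since 1 and \<open>z\<close> form a real basis of the plane, the integer parts of the
  two coordinates can be split off. The bounds are closed so that the remainders range over a
  compact set.\<close>

lemma lattice_decomposition: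
  assumes "Im z > 0"
  obtains m n :: int and s t :: real where
    "u = of_int m + of_int n * z + (of_real s + of_real t * z)"
    "0 \<le> s" "s \<le> 1" "0 \<le> t" "t \<le> 1"
proof -
  define y where "y = Im u / Im z"
  define x where "x = Re u - y * Re z"
  have "u = of_real x + of_real y * z"
    using assms by (simp add: complex_eq_iff x_def y_def)
  also have "\<dots> = of_int \<lfloor>x\<rfloor> + of_int \<lfloor>y\<rfloor> * z + (of_real (frac x) + of_real (frac y) * z)"
    by (simp add: frac_def algebra_simps)
  finally show ?thesis
    by (rule that) (auto simp: frac_ge_0 less_imp_le[OF frac_lt_1])
qed

text \<open>The quotient of the two functions is an elliptic function without poles.\<close>

lemma quasi_periodic_unique:
  fixes f g L M :: "complex \<Rightarrow> complex"
  assumes z: "Im z > 0"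
    and f: "f holomorphic_on UNIV" and g: "g holomorphic_on UNIV"
    and f1: "\<And>u. f (u + 1) = L u * f u" and g1: "\<And>u. g (u + 1) = L u * g u"
    and fz: "\<And>u. f (u + z) = M u * f u" and gz: "\<And>u. g (u + z) = M u * g u"
    and L: "\<And>u. L u \<noteq> 0" and M: "\<And>u. M u \<noteq> 0"
    and zeros: "\<And>u. g u = 0 \<Longrightarrow> \<exists>m n :: int. u = of_int m + of_int n * z"
    and f0: "f 0 = 0" and g0: "g 0 = 0"
    and Df: "(f has_field_derivative D) (at 0)" and Dg: "(g has_field_derivative D) (at 0)"
    and D: "D \<noteq> 0"
    and u: "g u \<noteq> 0"
  shows "f u = g u"
proof -
  \<comment> \<open>The value 1 at zeros of \<open>g\<close> is the limit of \<open>f / g\<close> at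
    0, and periodicity carries it to every lattice point.\<close>
  define h where "h = (\<lambda>u. if g u = 0 then 1 else f u / g u)"
  \<comment> \<open>The common multipliers cancel in the quotient. As they never vanish, the zero
    set of \<open>g\<close> is itself periodic, so both cases in \<open>h\<close> match.\<close>
  have "h (u + 1) = h u" "h (u + z) = h u" for u
    using L[of u] M[of u] by (auto simp: h_def f1 g1 fz gz)
  then have hm: "h (u + of_int m) = h u" and hn: "h (u + of_int n * z) = h u" for u m n
    using shift_invariant_int[of "\<lambda>m. h (u + of_int m)" m]
      shift_invariant_int[of "\<lambda>n. h (u + of_int n * z)" n]
    by (simp_all add: distrib_right add.assoc[symmetric])
  have per: "h (u + (of_int m + of_int n * z)) = h u" for u m n
    using hm[of "u + of_int n * z" m] hn[of u n] by (simp add: algebra_simps)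

  have lim: "((\<lambda>w. f w / g w) \<longlongrightarrow> 1) (at 0)"
    by (rule lhopital_complex_simple[OF Df Dg f0 g0 D]) (use D in simp)
  \<comment> \<open>Division by zero yields 0, so a nonzero quotient certifies \<open>g w\<close> to
    be nonzero: 0 is an isolated zero of \<open>g\<close>.\<close>
  then have "eventually (\<lambda>w. f w / g w \<noteq> 0) (at 0)"
    by (rule tendsto_imp_eventually_ne) simp
  then obtain r where r: "r > 0" "\<And>w. w \<noteq> 0 \<Longrightarrow> dist w 0 < r \<Longrightarrow> g w \<noteq> 0"
    unfolding eventually_at by fastforce
  have gball: "g w \<noteq> 0" if "w \<in> ball 0 r - {0}" for w
    using r(2)[of w] that by (auto simp: dist_commute)
  have hol0: "h holomorphic_on ball 0 r"
  proof (rule no_isolated_singularity'[where K = "{0}"])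
    have "eventually (\<lambda>w. w \<in> ball 0 r - {0}) (at 0)"
      using r(1) by (intro eventually_at_in_open) auto
    then have "eventually (\<lambda>w. f w / g w = h w) (at 0)"
      by eventually_elim (use gball in \<open>auto simp: h_def\<close>)
    then have "(h \<longlongrightarrow> 1) (at 0)"
      using lim by (rule Lim_transform_eventually[rotated])
    then show "(h \<longlongrightarrow> h w) (at w within ball 0 r)" if "w \<in> {0}" for w
      using that by (auto simp: h_def g0 intro: tendsto_within_subset)
    have "(\<lambda>w. f w / g w) holomorphic_on ball 0 r - {0}"
      using gball f g by (intro holomorphic_intros) (auto intro: holomorphic_on_subset)
    then show "h holomorphic_on ball 0 r - {0}"
      by (rule holomorphic_transform) (use gball in \<open>auto simp: h_def\<close>)
  qed auto
  have diff0: "h field_differentiable (at 0)"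
    using hol0 r(1) by (auto intro: holomorphic_on_imp_differentiable_at)
  have diff: "h field_differentiable (at w)" for w
  proof (cases "g w = 0")
    case True
    then obtain m n :: int where w: "w = of_int m + of_int n * z" using zeros by blast
    \<comment> \<open>By periodicity, \<open>h\<close> near the lattice point \<open>w\<close> is a
      translate of \<open>h\<close> near 0.\<close>
    have eq: "h = h \<circ> (\<lambda>v. v - w)"
      using per[of "v - w" m n for v] by (auto simp: w fun_eq_iff)
    have "(h \<circ> (\<lambda>v. v - w)) field_differentiable (at w)"
      by (rule field_differentiable_compose) (auto intro!: derivative_intros simp: diff0)
    then show ?thesis using eq by simp
  next
    case False
    have op: "open (g -` (- {0}))"
      using g by (intro open_vimage) (auto intro: holomorphic_on_imp_continuous_on)
    have "(\<lambda>w. f w / g w) holomorphic_on g -` (- {0})"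
      using f g by (intro holomorphic_intros) (auto intro: holomorphic_on_subset)
    then have "h holomorphic_on g -` (- {0})"
      by (rule holomorphic_transform) (auto simp: h_def)
    then show ?thesis
      using op False by (auto intro: holomorphic_on_imp_differentiable_at)
  qed
  then have hol: "h holomorphic_on UNIV"
    by (simp add: holomorphic_on_def field_differentiable_at_within)
  \<comment> \<open>\<open>K\<close> is the closed period parallelogram; all values of
    \<open>h\<close> are already taken on this compact set.\<close>
  define K where "K = (\<lambda>(s, t). of_real s + of_real t * z) ` ({0..1} \<times> {0..1 :: real})"
  have "compact K"
    unfolding K_def case_prod_unfold
    by (intro compact_continuous_image continuous_intros compact_Times) auto
  then have "bounded (h ` K)"
    by (intro compact_imp_bounded compact_continuous_image)
       (auto intro: holomorphic_on_imp_continuous_on holomorphic_on_subset[OF hol])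
  moreover have "range h \<subseteq> h ` K"
  proof safe
    fix u
    obtain m n :: int and s t :: real where
      *: "u = of_int m + of_int n * z + (of_real s + of_real t * z)"
      "0 \<le> s" "s \<le> 1" "0 \<le> t" "t \<le> 1"
      using lattice_decomposition[OF z] .
    have "h u = h (of_real s + of_real t * z)"
      using per[of "of_real s + of_real t * z" m n] by (simp add: *(1) add.commute)
    then show "h u \<in> h ` K"
      using *(2-) by (force simp: K_def)
  qed
  ultimately have "bounded (range h)"
    by (rule bounded_subset)
  then have "h constant_on UNIV"
    using hol by (intro Liouville_theorem)
  then have "h u = h 0"
    by (auto simp: constant_on_def)
  then show ?thesis
    using u by (simp add: h_def g0)
qed

subsection \<open>The product \<open>\<Prod>m. 1 - x q\<^sup>m\<close>\<close>

text \<open>This is the q-Pochhammer symbol (x; q) with infinitely many factors.\<close>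

definition qprod :: "complex \<Rightarrow> complex \<Rightarrow> complex" where
  "qprod q x = (\<Prod>m. 1 - x * q ^ m)"

context
  fixes q :: complex
  assumes q: "norm q < 1"
begin

lemma convergent_qprod: "convergent_prod (\<lambda>m. 1 - x * q ^ m)"
proof -
  have "summable (\<lambda>m. norm x * norm q ^ m)"
    using q by (intro summable_mult summable_geometric) simp
  then show ?thesis
    by (intro abs_convergent_prod_imp_convergent_prod summable_imp_abs_convergent_prod)
       (simp add: norm_mult norm_power)
qed

text \<open>Splits off the factor for \<open>m = 0\<close>. Both the quasi-period \<open>z\<close>
  and the simple zero at 0 of the Klein form come from this recursion.\<close>

lemma qprod_rec: "qprod q x = (1 - x) * qprod q (q * x)"
  using has_prod_unique[OF has_prod_ignore_initial_segment'[OF convergent_qprod[of x], of 1]]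
  by (simp add: qprod_def mult_ac)

lemma qprod_eq_0D:
  assumes "qprod q x = 0"
  obtains m where "x * q ^ m = 1"
  using prodinf_nonzero[OF convergent_qprod[of x]] assms by (auto simp: qprod_def)

lemma qprod_self_nonzero: "qprod q q \<noteq> 0"
proof
  assume "qprod q q = 0"
  then obtain m where m: "q * q ^ m = 1" by (rule qprod_eq_0D)
  have "norm (q * q ^ m) \<le> norm q"
    unfolding norm_mult norm_power using q by (intro mult_right_le_one_le power_le_one) auto
  with m q show False by simp
qed

text \<open>On a unit disc around \<open>x\<close> the terms have a geometric majorant, so the
  partial products converge uniformly; their limit agrees pointwise with
  \<open>qprod q\<close>.\<close>

lemma holomorphic_qprod: "qprod q holomorphic_on UNIV"
proof (rule holomorphic_uniform_sequence)
  show "(\<lambda>x. \<Prod>m<n. 1 - x * q ^ m) holomorphic_on UNIV" for n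
    by (intro holomorphic_intros)
  fix x :: complex
  have "uniformly_convergent_on (cball x 1) (\<lambda>N y. \<Prod>m<N. 1 - y * q ^ m)"
  proof (rule uniformly_convergent_on_prod')
    show "uniformly_convergent_on (cball x 1) (\<lambda>N y. \<Sum>m<N. norm (1 - y * q ^ m - 1))"
    proof (rule Weierstrass_m_test'_ev)
      have "norm (y * q ^ m) \<le> (norm x + 1) * norm q ^ m" if "y \<in> cball x 1" for y m
        unfolding norm_mult norm_power
        by (intro mult_right_mono) (use that norm_triangle_sub[of y x] in \<open>auto simp: dist_norm norm_minus_commute\<close>)
      then show "\<forall>\<^sub>F m in sequentially. \<forall>y\<in>cball x 1. norm (norm (1 - y * q ^ m - 1)) \<le> (norm x + 1) * norm q ^ m"
        by simp
      show "summable (\<lambda>m. (norm x + 1) * norm q ^ m)"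
        using q by (intro summable_mult summable_geometric) simp
    qed
  qed (auto intro!: continuous_intros)
  then obtain l where l: "uniform_limit (cball x 1) (\<lambda>N y. \<Prod>m<N. 1 - y * q ^ m) l sequentially"
    by (auto simp: uniformly_convergent_on_def)
  have "l y = qprod q y" if "y \<in> cball x 1" for y
  proof (rule LIMSEQ_unique)
    show "(\<lambda>N. \<Prod>m<N. 1 - y * q ^ m) \<longlonglongrightarrow> l y"
      using tendsto_uniform_limitI[OF l that] .
    show "(\<lambda>N. \<Prod>m<N. 1 - y * q ^ m) \<longlonglongrightarrow> qprod q y"
      unfolding qprod_def
      by (intro has_prod_imp_tendsto' convergent_prod_has_prod convergent_qprod)
  qed
  then have "uniform_limit (cball x 1) (\<lambda>N y. \<Prod>m<N. 1 - y * q ^ m) (qprod q) sequentially"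
    using l by (subst uniform_limit_cong'[where h = l and i = "qprod q", symmetric]) auto
  then show "\<exists>d>0. cball x d \<subseteq> UNIV \<and> uniform_limit (cball x d) (\<lambda>N y. \<Prod>m<N. 1 - y * q ^ m) (qprod q) sequentially"
    by (intro exI[of _ 1]) auto
qed auto

end

lemma holomorphic_on_qprod [holomorphic_intros]:
  assumes "norm q < 1" "f holomorphic_on A"
  shows "(\<lambda>u. qprod q (f u)) holomorphic_on A"
  using holomorphic_on_compose_gen[OF assms(2) holomorphic_qprod[OF assms(1)]]
  by (simp add: o_def)

subsection \<open>Klein forms\<close>

lemma qpow_add: "qpow r (u + v) = qpow r u * qpow r v"
  by (simp add: qpow_def ring_distribs exp_add)

lemma qpow_nonzero [simp]: "qpow r u \<noteq> 0"
  by (simp add: qpow_def)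

lemma qpow_0_right [simp]: "qpow r 0 = 1"
  by (simp add: qpow_def)

lemma qpow_minus: "qpow r (- u) = inverse (qpow r u)"
  by (simp add: qpow_def exp_minus)

lemma qpow_of_nat_mult: "qpow r (of_nat m * u) = qpow r u ^ m"
  by (simp add: qpow_def mult_ac flip: exp_of_nat_mult)

lemma qpow_of_nat: "qpow (real m) u = qpow 1 u ^ m"
  by (simp add: qpow_def mult_ac flip: exp_of_nat_mult)

lemma qpow_of_int [simp]: "qpow 1 (of_int n) = 1"
  using exp_pi_i_even[of n] by (simp add: qpow_def mult_ac)

lemma qpow_eq_1D:
  assumes "qpow 1 u = 1"
  obtains n :: int where "u = of_int n"
proof -
  from assms obtain n :: int where n: "Re (2 * of_real pi * \<i> * u) = 0"
    "Im (2 * of_real pi * \<i> * u) = of_int (2 * n) * pi"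
    by (auto simp: qpow_def exp_eq_1)
  then have "u = of_int n" by (simp add: complex_eq_iff)
  then show ?thesis by (rule that)
qed

lemma norm_qpow_less_1: "Im z > 0 \<Longrightarrow> norm (qpow 1 z) < 1"
  by (simp add: qpow_def)

lemma holomorphic_on_qpow [holomorphic_intros]:
  "f holomorphic_on A \<Longrightarrow> (\<lambda>u. qpow r (f u)) holomorphic_on A"
  unfolding qpow_def by (intro holomorphic_intros)

text \<open>
  This is \<open>-\<i> \<theta>\<^sub>1(u, z) / \<eta>(z)\<^sup>3\<close>.
\<close>

definition klein :: "complex \<Rightarrow> complex \<Rightarrow> complex" where
  "klein u z = exp (- (of_real pi * \<i> * u)) *
     (qprod (qpow 1 z) (qpow 1 u) * qprod (qpow 1 z) (qpow 1 z / qpow 1 u)) /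
     (qprod (qpow 1 z) (qpow 1 z))\<^sup>2"

context
  fixes z :: complex
  assumes z: "Im z > 0"
begin

lemma klein_add_int:
  "klein (u + of_int n) z = exp (of_real pi * \<i> * of_int n) * klein u z"
proof -
  have "exp (- (of_real pi * \<i> * (u + of_int n))) =
      exp (of_real pi * \<i> * of_int n) * exp (- (of_real pi * \<i> * u))"
    unfolding exp_pi_i_minus[symmetric] exp_add[symmetric] by (simp add: algebra_simps)
  then show ?thesis
    by (simp add: klein_def qpow_add)
qed

text \<open>The shift replaces \<open>x\<close> by \<open>x * q\<close>. One factor moves between
  the two products, and (1 - 1/x) = -(1 - x)/x gives the multiplier, without dividing by 1 -
  x.\<close>

lemma klein_add_period:
  "klein (u + z) z = - exp (- (of_real pi * \<i> * (z + 2 * u))) * klein u z"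
proof -
  define q where "q = qpow 1 z"
  define x where "x = qpow 1 u"
  note q = norm_qpow_less_1[OF z, folded q_def]
  have [simp]: "q \<noteq> 0" "x \<noteq> 0" by (simp_all add: q_def x_def)
  have e: "exp (- (of_real pi * \<i> * (z + 2 * u))) = exp (- (of_real pi * \<i> * z)) / x"
    by (simp add: x_def qpow_def ring_distribs exp_diff exp_minus field_simps)
  have e': "exp (- (of_real pi * \<i> * (u + z))) =
      exp (- (of_real pi * \<i> * u)) * exp (- (of_real pi * \<i> * z))"
    by (simp add: ring_distribs flip: exp_add)
  have "qprod q (x * q) * qprod q (1 / x) = - (qprod q x * qprod q (q / x)) / x"
    unfolding qprod_rec[OF q, of x] qprod_rec[OF q, of "1 / x"] by (simp add: field_simps)
  then show ?thesis
    unfolding klein_def e e' qpow_add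
    by (simp flip: q_def x_def)
qed

lemma klein_add_lattice:
  "klein (u + of_int m * z + of_int n) z =
     exp (of_real pi * \<i> * (of_int m + of_int n - of_int m ^ 2 * z - 2 * of_int m * u)) * klein u z"
proof -
  \<comment> \<open>Dividing by the expected multiplier turns the claim for multiples of
    \<open>z\<close> into invariance of \<open>G\<close> under \<open>m + 1\<close>.\<close>
  define G where "G m = klein (u + of_int m * z) z *
      exp (- (of_real pi * \<i> * (of_int m - of_int m ^ 2 * z - 2 * of_int m * u)))" for m :: int
  have "G (k + 1) = G k" for k
  proof -
    define A B :: complex where
      "A = - (of_real pi * \<i> * (z + 2 * (u + of_int k * z)))" and
      "B = - (of_real pi * \<i> * (of_int (k + 1) - of_int (k + 1) ^ 2 * z - 2 * of_int (k + 1) * u))"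
    have "klein (u + of_int (k + 1) * z) z = - exp A * klein (u + of_int k * z) z"
      using klein_add_period[of "u + of_int k * z"] by (simp add: A_def ring_distribs add.assoc)
    then have "G (k + 1) = klein (u + of_int k * z) z * (- (exp A * exp B))"
      by (simp add: G_def B_def)
    \<comment> \<open>The sign is absorbed as exp(pi i), which supplies the linear term of the
      exponent.\<close>
    also have "- (exp A * exp B) = exp (of_real pi * \<i>) * (exp A * exp B)"
      by simp
    also have "\<dots> = exp (- (of_real pi * \<i> * (of_int k - of_int k ^ 2 * z - 2 * of_int k * u)))"
      unfolding exp_add[symmetric] A_def B_def by (simp add: algebra_simps power2_eq_square)
    finally show ?thesis by (simp add: G_def)
  qed
  then have "G m = klein u z"
    using shift_invariant_int[of G m] by (simp add: G_def)
  then have "klein (u + of_int m * z) z =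
      exp (of_real pi * \<i> * (of_int m - of_int m ^ 2 * z - 2 * of_int m * u)) * klein u z"
    unfolding G_def by (metis exp_minus_inverse mult.assoc mult.commute mult_1)
  moreover have "exp (of_real pi * \<i> * (of_int m + of_int n - of_int m ^ 2 * z - 2 * of_int m * u)) =
      exp (of_real pi * \<i> * of_int n) *
      exp (of_real pi * \<i> * (of_int m - of_int m ^ 2 * z - 2 * of_int m * u))"
    unfolding exp_add[symmetric] by (simp add: algebra_simps)
  ultimately show ?thesis
    by (simp add: klein_add_int)
qed

text \<open>A vanishing factor of either product means that \<open>qpow 1\<close> is 1 at u + mz or
  at (m + 1)z - u, which is then an integer.\<close>

lemma klein_eq_0D:
  assumes "klein u z = 0"
  shows "\<exists>m n :: int. u = of_int m + of_int n * z"
proof -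
  note q = norm_qpow_less_1[OF z]
  from assms consider "qprod (qpow 1 z) (qpow 1 u) = 0"
    | "qprod (qpow 1 z) (qpow 1 z / qpow 1 u) = 0"
    using qprod_self_nonzero[OF q] by (auto simp: klein_def)
  then show ?thesis
  proof cases
    case 1
    then obtain m where "qpow 1 u * qpow 1 z ^ m = 1"
      using qprod_eq_0D[OF q] by metis
    then have "qpow 1 (u + of_nat m * z) = 1"
      by (simp add: qpow_add qpow_of_nat_mult)
    then obtain n :: int where "u + of_nat m * z = of_int n" by (rule qpow_eq_1D)
    then show ?thesis
      by (intro exI[of _ n] exI[of _ "- int m"]) (simp add: algebra_simps)
  next
    case 2
    then obtain m where "qpow 1 z / qpow 1 u * qpow 1 z ^ m = 1"
      using qprod_eq_0D[OF q] by metis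
    then have "qpow 1 (of_nat (Suc m) * z + - u) = 1"
      unfolding qpow_add qpow_of_nat_mult qpow_minus by (simp add: field_simps)
    then obtain n :: int where "of_nat (Suc m) * z + - u = of_int n" by (rule qpow_eq_1D)
    then show ?thesis
      by (intro exI[of _ "- n"] exI[of _ "int (Suc m)"]) (simp add: algebra_simps)
  qed
qed

lemma klein_0: "klein 0 z = 0"
  using qprod_rec[OF norm_qpow_less_1[OF z], of 1] by (simp add: klein_def)

lemma holomorphic_klein: "(\<lambda>u. klein u z) holomorphic_on UNIV"
  unfolding klein_def using norm_qpow_less_1[OF z] qprod_self_nonzero[OF norm_qpow_less_1[OF z]]
  by (intro holomorphic_intros) auto

lemma has_field_derivative_klein_0:
  "((\<lambda>u. klein u z) has_field_derivative - (2 * of_real pi * \<i>)) (at 0)"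
proof -
  note q = norm_qpow_less_1[OF z]
  \<comment> \<open>\<open>N\<close> is the Klein form with the factor \<open>1 - qpow 1 u\<close>
    removed. The denominator makes \<open>N 0 = 1\<close>, so the derivative at 0 does not depend on
    \<open>z\<close>.\<close>
  define N where "N u = exp (- (of_real pi * \<i> * u)) *
     (qprod (qpow 1 z) (qpow 1 z * qpow 1 u) * qprod (qpow 1 z) (qpow 1 z / qpow 1 u)) /
     (qprod (qpow 1 z) (qpow 1 z))\<^sup>2" for u
  have "N holomorphic_on UNIV"
    unfolding N_def using q qprod_self_nonzero[OF q] by (intro holomorphic_intros) auto
  then obtain N' where N': "(N has_field_derivative N') (at 0)"
    by (auto simp: holomorphic_on_def field_differentiable_def)
  have N0: "N 0 = 1"
    using qprod_self_nonzero[OF q] by (simp add: N_def power2_eq_square)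
  have eq: "(\<lambda>u. klein u z) = (\<lambda>u. (1 - qpow 1 u) * N u)"
    by (subst klein_def, subst qprod_rec[OF q]) (simp add: N_def mult_ac)
  have "(qpow 1 has_field_derivative 2 * of_real pi * \<i>) (at 0)"
    unfolding qpow_def[abs_def] by (auto intro!: derivative_eq_intros)
  then have "((\<lambda>u. (1 - qpow 1 u) * N u) has_field_derivative
      (0 - 2 * of_real pi * \<i>) * N 0 + N' * (1 - qpow 1 0)) (at 0)"
    by (intro DERIV_mult DERIV_diff DERIV_const N')
  then show ?thesis
    by (simp add: eq N0)
qed

end

section \<open>Klein forms under integer matrices of determinant 1\<close>

lemma moebius_Im_pos:
  fixes a b c d :: int
  assumes det: "a * d - b * c = 1" and z: "Im z > 0"
  shows "of_int c * z + of_int d \<noteq> 0"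
    and "Im ((of_int a * z + of_int b) / (of_int c * z + of_int d)) > 0"
proof -
  show nz: "of_int c * z + of_int d \<noteq> 0"
  proof
    assume *: "of_int c * z + of_int d = 0"
    then have "Im (of_int c * z + of_int d) = 0" by simp
    then have "c = 0" using z by simp
    with * det show False by simp
  qed
  have det': "real_of_int a * of_int d - of_int b * of_int c = 1"
    using det by (metis of_int_1 of_int_diff of_int_mult)
  have "Im ((of_int a * z + of_int b) / (of_int c * z + of_int d)) =
      ((of_int a * of_int d - of_int b * of_int c) * Im z) / norm (of_int c * z + of_int d) ^ 2"
    by (simp add: Im_divide cmod_power2 algebra_simps)
  then show "Im ((of_int a * z + of_int b) / (of_int c * z + of_int d)) > 0"
    using nz z det' by simp
qed

lemma klein_modular:
  fixes a b c d :: int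
  assumes det: "a * d - b * c = 1" and z: "Im z > 0" and u: "klein u z \<noteq> 0"
  defines "j \<equiv> of_int c * z + of_int d"
  shows "j * exp (- (of_real pi * \<i> * (of_int c * u\<^sup>2 / j))) *
           klein (u / j) ((of_int a * z + of_int b) / j) = klein u z"
proof -
  define z' where "z' = (of_int a * z + of_int b) / j"
  \<comment> \<open>\<open>J\<close> is 1/j written as a lattice vector for \<open>z'\<close>;
    likewise z/j = d z' - b. Dividing the periods 1 and \<open>z\<close> by \<open>j\<close>
    therefore lands in the lattice of \<open>z'\<close>, where \<open>klein_add_lattice\<close>
    applies.\<close>
  define J where "J = of_int a - of_int c * z'"
  have j0: "j \<noteq> 0" and z': "Im z' > 0"
    using moebius_Im_pos[OF det z] by (simp_all add: j_def z'_def)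
  have detc: "of_int a * of_int d - of_int b * of_int c = (1 :: complex)"
    using det by (metis of_int_1 of_int_diff of_int_mult)
  have jz': "j * z' = of_int a * z + of_int b"
    using j0 by (simp add: z'_def)
  have jJ: "j * J = 1"
    using jz' detc unfolding J_def j_def by algebra
  then have inv: "x / j = x * J" for x
    using j0 by (simp add: field_simps)
  have zJ: "z * J = of_int d * z' - of_int b"
    using jz' detc unfolding J_def j_def by algebra
  define f where "f u = j * exp (- (of_real pi * \<i> * (of_int c * u\<^sup>2 * J))) * klein (u * J) z'" for u
  \<comment> \<open>a + c + ac = (1 + a)(1 + c) - 1 is odd unless \<open>a\<close> and
    \<open>c\<close> are both even, which the determinant excludes; the same holds for
    \<open>b\<close> and \<open>d\<close>.\<close>
  have par: "odd (a - c - a * c)" "odd (d - b - b * d)"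
    using det by (auto simp: algebra_simps)
       (metis even_add even_mult_iff odd_one)+
  have f1: "f (u + 1) = - 1 * f u" for u
  proof -
    have "(u + 1) * J = u * J + of_int (- c) * z' + of_int a"
      by (simp add: J_def algebra_simps)
    then have "f (u + 1) = j * (exp (- (of_real pi * \<i> * (of_int c * (u + 1)\<^sup>2 * J))) *
        exp (of_real pi * \<i> * (of_int (- c) + of_int a - of_int (- c) ^ 2 * z' - 2 * of_int (- c) * (u * J)))) *
        klein (u * J) z'"
      by (simp only: f_def klein_add_lattice[OF z'] mult.assoc)
    \<comment> \<open>The quadratic exponential cancels the terms in \<open>u\<close> and
      \<open>z'\<close> of the lattice multiplier, leaving the sign given by a - c - ac.\<close>
    also have "exp (- (of_real pi * \<i> * (of_int c * (u + 1)\<^sup>2 * J))) *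
        exp (of_real pi * \<i> * (of_int (- c) + of_int a - of_int (- c) ^ 2 * z' - 2 * of_int (- c) * (u * J))) =
        exp (of_real pi * \<i> * of_int (a - c - a * c)) * exp (- (of_real pi * \<i> * (of_int c * u\<^sup>2 * J)))"
      unfolding exp_add[symmetric] by (simp add: J_def algebra_simps power2_eq_square)
    finally show ?thesis
      unfolding exp_pi_i_odd[OF par(1)] by (simp add: f_def)
  qed
  have fz: "f (u + z) = - exp (- (of_real pi * \<i> * (z + 2 * u))) * f u" for u
  proof -
    have "(u + z) * J = u * J + of_int d * z' + of_int (- b)"
      by (simp add: zJ ring_distribs)
    then have *: "f (u + z) = j * (exp (- (of_real pi * \<i> * (of_int c * (u + z)\<^sup>2 * J))) *
        exp (of_real pi * \<i> * (of_int d + of_int (- b) - of_int d ^ 2 * z' - 2 * of_int d * (u * J)))) *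
        klein (u * J) z'"
      by (simp only: f_def klein_add_lattice[OF z'] mult.assoc)
    \<comment> \<open>The exponent is reduced using \<open>jJ\<close>, \<open>zJ\<close>,
      \<open>jz'\<close> and the determinant in turn, until only the multiplier of
      \<open>klein u z\<close> and the parity term b - d + bd remain.\<close>
    have "of_int c * (u + z)\<^sup>2 * J + of_int d ^ 2 * z' + 2 * of_int d * (u * J) =
        of_int c * u\<^sup>2 * J + 2 * u * (j * J) + of_int c * z * (z * J) + of_int d ^ 2 * z'"
      by (simp add: j_def algebra_simps power2_eq_square)
    also have "\<dots> = of_int c * u\<^sup>2 * J + 2 * u + of_int d * (j * z') - of_int b * of_int c * z"
      unfolding jJ zJ by (simp add: j_def algebra_simps power2_eq_square)
    also have "\<dots> = of_int c * u\<^sup>2 * J + of_int b * of_int d +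
        (of_int a * of_int d - of_int b * of_int c) * z + 2 * u"
      unfolding jz' by (simp add: algebra_simps)
    also have "\<dots> = of_int c * u\<^sup>2 * J + of_int b * of_int d + z + 2 * u"
      unfolding detc by simp
    finally have "of_int d + of_int (- b) - of_int d ^ 2 * z' - 2 * of_int d * (u * J)
          - of_int c * (u + z)\<^sup>2 * J =
        of_int (d - b - b * d) - (z + 2 * u) - of_int c * u\<^sup>2 * J"
      by (simp add: algebra_simps)
    then have "of_real pi * \<i> * (of_int d + of_int (- b) - of_int d ^ 2 * z' - 2 * of_int d * (u * J)
          - of_int c * (u + z)\<^sup>2 * J) =
        of_real pi * \<i> * (of_int (d - b - b * d) - (z + 2 * u) - of_int c * u\<^sup>2 * J)"
      by (rule arg_cong)
    then have "- (of_real pi * \<i> * (of_int c * (u + z)\<^sup>2 * J)) +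
        of_real pi * \<i> * (of_int d + of_int (- b) - of_int d ^ 2 * z' - 2 * of_int d * (u * J)) =
        of_real pi * \<i> * of_int (d - b - b * d) + (- (of_real pi * \<i> * (z + 2 * u))
          + - (of_real pi * \<i> * (of_int c * u\<^sup>2 * J)))"
      by (simp only: right_diff_distrib) (simp only: diff_conv_add_uminus add_ac)
    then show ?thesis
      unfolding * exp_add[symmetric]
      by (simp only:) (simp only: exp_add exp_pi_i_odd[OF par(2)], simp add: f_def)
  qed
  have kJ: "(\<lambda>u. klein (u * J) z') holomorphic_on UNIV"
    by (rule holomorphic_on_compose_gen[OF _ holomorphic_klein[OF z'], unfolded o_def])
       (auto intro!: holomorphic_intros)
  have "f u = klein u z"
  proof (rule quasi_periodic_unique[OF z _ holomorphic_klein[OF z], where L = "\<lambda>_. - 1"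
        and M = "\<lambda>u. - exp (- (of_real pi * \<i> * (z + 2 * u)))"])
    show "f holomorphic_on UNIV"
      unfolding f_def by (intro holomorphic_intros kJ)
    show "klein (u + 1) z = - 1 * klein u z" for u
      using klein_add_int[OF z, of u 1] by simp
    show "f 0 = 0"
      by (simp add: f_def klein_0[OF z'])
    have "((\<lambda>u. klein (u * J) z') has_field_derivative - (2 * of_real pi * \<i>) * J) (at 0)"
      by (rule DERIV_chain2[where f = "\<lambda>u. klein u z'"])
        (auto intro!: derivative_eq_intros has_field_derivative_klein_0[OF z'])
    \<comment> \<open>The chain rule contributes \<open>J\<close> and the prefactor
      \<open>j\<close>; the derivative of the exponential drops out because the Klein form vanishes
      at 0.\<close>
    then have "(f has_field_derivative - (2 * of_real pi * \<i>) * (j * J)) (at 0)"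
      unfolding f_def[abs_def] by (auto intro!: derivative_eq_intros simp: klein_0[OF z'])
    then show "(f has_field_derivative - (2 * of_real pi * \<i>)) (at 0)"
      by (simp add: jJ)
  qed (use f1 fz u in \<open>auto simp: klein_add_period[OF z] klein_0[OF z]
      intro: klein_eq_0D[OF z] has_field_derivative_klein_0[OF z]\<close>)
  then show ?thesis
    by (simp add: f_def inv z'_def)
qed

subsection \<open>The functions \<open>F1\<close>\<close>

lemma zeta_pow_eq_qpow: "zeta_pow p l = qpow 1 (of_int l / of_nat p)"
  by (simp add: zeta_pow_def qpow_def)

lemma zeta_pow_mod:
  assumes "p > 0"
  shows "zeta_pow p (l mod int p) = zeta_pow p l"
proof -
  have "complex_of_int l = of_int (int p * (l div int p) + l mod int p)"
    by simp
  also have "\<dots> = of_nat p * of_int (l div int p) + of_int (l mod int p)"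
    by (simp only: of_int_add of_int_mult of_int_of_nat_eq)
  finally have "of_int l / of_nat p = (of_int (l mod int p) / of_nat p + of_int (l div int p) :: complex)"
    using assms by (simp add: add_divide_distrib)
  then show ?thesis
    by (simp add: zeta_pow_eq_qpow qpow_add)
qed

text \<open>The fractional powers of q cancel: the square of q^(1/24) is the q^(1/12) of
  \<open>E0\<close>.\<close>

lemma F1_eq:
  assumes z: "Im z > 0"
  shows "F1 p l z = (qprod (qpow 1 z) (qpow 1 z))\<^sup>2 /
    (qprod (qpow 1 z) (zeta_pow p l) * qprod (qpow 1 z) (qpow 1 z / zeta_pow p l))"
proof -
  note q = norm_qpow_less_1[OF z]
  have eta: "dedekind_eta z = qpow (1/24) z * qprod (qpow 1 z) (qpow 1 z)"
    unfolding dedekind_eta_def qprod_def qpow_of_nat by simp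
  have neg: "zeta_pow p (- l) = 1 / zeta_pow p l"
    by (simp add: zeta_pow_eq_qpow qpow_minus inverse_eq_divide)
  have E0: "E0 p l z = qpow (1/12) z *
      (qprod (qpow 1 z) (zeta_pow p l) * qprod (qpow 1 z) (qpow 1 z / zeta_pow p l))"
    unfolding E0_def qprod_def prodinf_mult[OF convergent_qprod[OF q] convergent_qprod[OF q]]
      qpow_of_nat neg by simp
  have "(qpow (1/24) z)\<^sup>2 = qpow (1/12) z"
    by (simp add: qpow_def mult_ac flip: exp_double)
  then show ?thesis
    by (simp add: F1_def eta E0 power_mult_distrib)
qed

text \<open>\<open>F1\<close> depends on \<open>l\<close> only through the root of unity
  \<open>zeta_pow p l\<close>.\<close>

lemma F1_mod: "p > 0 \<Longrightarrow> Im z > 0 \<Longrightarrow> F1 p (l mod int p) z = F1 p l z"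
  by (simp add: F1_eq zeta_pow_mod)

lemma F1_eq_klein:
  assumes "Im z > 0"
  shows "F1 p l z = exp (- (of_real pi * \<i> * (of_int l / of_nat p))) / klein (of_int l / of_nat p) z"
  by (simp add: F1_eq[OF assms] klein_def zeta_pow_eq_qpow)

theorem theorem2p2:
  fixes p :: nat and l a b c d :: int and z :: complex
  assumes "prime p" and "p > 3"
    and "1 \<le> l" and "l \<le> int p - 1"
    and "Gamma0 p a b c d"
    and "Im z > 0"
  shows "slash 1 a b c d (F1 p l) z = mu p c d l * F1 p ((d * l) mod int p) z"
proof -
  note z = \<open>Im z > 0\<close>
  have det: "a * d - b * c = 1" and pc: "int p dvd c"
    using assms(5) by (auto simp: Gamma0_def)
  have p: "p > 0" using assms(2) by simp
  define x :: complex where "x = of_int l / of_nat p"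
  define j where "j = of_int c * z + of_int d"
  define z' where "z' = (of_int a * z + of_int b) / j"
  have j0: "j \<noteq> 0" and z': "Im z' > 0"
    using moebius_Im_pos[OF det z] by (simp_all add: j_def z'_def)
  obtain k where k: "c = int p * k" using pc by (elim dvdE)
  \<comment> \<open>This is cl/p, an integer because \<open>p\<close> divides
    \<open>c\<close>.\<close>
  define m where "m = k * l"
  have cx: "of_int c * x = of_int m"
    using p by (simp add: x_def k m_def)
  \<comment> \<open>Hence dl/p is not a lattice point, which yields the nonvanishing required by
    \<open>klein_modular\<close>.\<close>
  have "\<not> int p dvd d * l"
  proof
    assume "int p dvd d * l"
    moreover have "prime (int p)" using assms(1) by simp
    moreover have "\<not> int p dvd l" using assms(3,4) zdvd_imp_le[of "int p" l] by auto
    ultimately have "int p dvd d" by (simp add: prime_dvd_mult_iff)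
    then have "int p dvd a * d - b * c" using pc by (intro dvd_diff dvd_mult)
    then show False using det \<open>prime (int p)\<close> not_prime_unit by auto
  qed
  moreover have "int p dvd d * l" if eq: "of_int d * x = of_int r + of_int n * z" for r n
  proof -
    have "Im (of_int d * x) = 0" by (simp add: x_def Im_divide_of_nat)
    then have "n = 0" using eq z by simp
    then have "of_int (d * l) = (of_int (int p * r) :: complex)"
      using eq p by (simp add: x_def field_simps)
    then show ?thesis unfolding of_int_eq_iff by simp
  qed
  ultimately have kd: "klein (of_int d * x) z \<noteq> 0"
    using klein_eq_0D[OF z] by blast
  have "x * j = of_int d * x + of_int m * z + of_int 0"
    unfolding j_def cx[symmetric] by (simp add: algebra_simps)
  then have ku: "klein (x * j) z =
      exp (of_real pi * \<i> * (of_int m + of_int 0 - of_int m ^ 2 * z - 2 * of_int m * (of_int d * x))) *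
      klein (of_int d * x) z"
    using klein_add_lattice[OF z] by metis
  have "klein (x * j) z \<noteq> 0"
    using kd by (simp add: ku)
  from klein_modular[OF det z this]
  have mod: "j * exp (- (of_real pi * \<i> * (of_int c * x\<^sup>2 * j))) * klein x z' = klein (x * j) z"
    unfolding j_def[symmetric] z'_def[symmetric] using j0 by (simp add: power2_eq_square mult_ac)
  have cx2: "of_int c * x\<^sup>2 * j = of_int m ^ 2 * z + of_int m * (of_int d * x)"
    unfolding j_def cx[symmetric] by (simp add: algebra_simps power2_eq_square)
  \<comment> \<open>The exponent of \<open>mu\<close> in terms of x = l/p and m = cx.\<close>
  have "of_int (l * (d - 1)) / of_nat p + of_int (c * d * l\<^sup>2) / of_nat p ^ 2 - of_int (c * l) / of_nat p =
      of_int d * x - x + of_int m * (of_int d * x) - of_int m"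
    using p unfolding cx[symmetric] x_def by (simp add: field_simps power2_eq_square)
  then have mu: "mu p c d l =
      exp (of_real pi * \<i> * (of_int d * x - x + of_int m * (of_int d * x) - of_int m))"
    by (simp only: mu_def)
  \<comment> \<open>\<open>A\<close> comes from the lattice shift, \<open>B\<close> from
    \<open>klein_modular\<close>. In the sum m^2 z cancels, leaving pi i (m - m d x).\<close>
  define A where "A = of_real pi * \<i> * (of_int m + of_int 0 - of_int m ^ 2 * z - 2 * of_int m * (of_int d * x))"
  define B where "B = of_real pi * \<i> * (of_int m ^ 2 * z + of_int m * (of_int d * x))"
  have "j * klein x z' = exp B * klein (x * j) z"
    using mod unfolding cx2 B_def[symmetric] by (simp add: exp_minus field_simps)
  also have "\<dots> = exp (B + A) * klein (of_int d * x) z"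
    unfolding ku A_def[symmetric] by (simp add: exp_add)
  finally have jk: "j * klein x z' = exp (B + A) * klein (of_int d * x) z" .
  have "slash 1 a b c d (F1 p l) z = exp (- (of_real pi * \<i> * x)) / (j * klein x z')"
    unfolding slash_def z'_def[unfolded j_def, symmetric] F1_eq_klein[OF z'] x_def[symmetric]
    by (simp add: power_int_minus j_def field_simps)
  also have "\<dots> = exp (- (of_real pi * \<i> * x) - (B + A)) / klein (of_int d * x) z"
    unfolding jk by (simp only: exp_diff divide_divide_eq_left)
  \<comment> \<open>The exponent splits into that of \<open>mu\<close> and the prefactor -pi i d x
    of \<open>F1 p (d * l)\<close> in \<open>F1_eq_klein\<close>.\<close>
  also have "- (of_real pi * \<i> * x) - (B + A) =
      of_real pi * \<i> * (of_int d * x - x + of_int m * (of_int d * x) - of_int m)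
      + - (of_real pi * \<i> * (of_int d * x))"
    unfolding A_def B_def by (simp add: algebra_simps)
  also have "exp \<dots> / klein (of_int d * x) z = mu p c d l * F1 p (d * l) z"
    unfolding exp_add mu[symmetric] F1_eq_klein[OF z] by (simp add: x_def)
  also have "F1 p (d * l) z = F1 p ((d * l) mod int p) z"
    using F1_mod[OF p z] by simp
  finally show ?thesis .
qed

end
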